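(* Let $\mathcal{K}\in L(\mathcal{X},\mathcal{U})$ be such that (i) the operator $\widetilde{\mathcal{A}}:=\mathcal{A}-\mathcal{B}\mathcal{K}:\mathcal{X}\to\mathcal{P}^*$ is invertible and $\sigma_{\mathcal{K}}:=\|\mathcal{C}\widetilde{\mathcal{A}}^{-1}\mathcal{B}\|_{\mathcal{U}\to\mathcal{Y}}$ is finite; (ii) $\delta_{\mathcal{K}}>0$ is a constant with $\|\mathcal{K}x\|_{\mathcal{U}}\le\delta_{\mathcal{K}}\|\mathcal{C}x\|_{\mathcal{Y}}$ for all $x\in\mathcal{X}$. Define $\widetilde{\mathcal{M}}_{\mathrm{red}}:\mathcal{U}\to\mathcal{U}^*$ by $$\widetilde{\mathcal{M}}_{\mathrm{red}}:=(\mathcal{C}\widetilde{\mathcal{A}}^{-1}\mathcal{B})^*\mathcal{R}_y\,\mathcal{C}\widetilde{\mathcal{A}}^{-1}\mathcal{B}+\alpha(\mathcal{K}\widetilde{\mathcal{A}}^{-1}\mathcal{B}+I)^*\mathcal{R}_u(\mathcal{K}\widetilde{\mathcal{A}}^{-1}\mathcal{B}+I).$$ Then for all $v\in\mathcal{U}$ $$\frac{\alpha}{1+\alpha\delta_{\mathcal{K}}^2}\|v\|_{\mathcal{U}}^2\le\langle v,\widetilde{\mathcal{M}}_{\mathrm{red}}v\rangle_{\mathcal{U},\mathcal{U}^*}\le\left(\sigma_{\mathcal{K}}^2+\alpha(1+\delta_{\mathcal{K}}\sigma_{\mathcal{K}})^2\right)\|v\|_{\mathcal{U}}^2,$$ and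 the condition number satisfies $$\kappa(\widetilde{\mathcal{M}}_{\mathrm{red}})\le(1+\alpha\delta_{\mathcal{K}}^2)\left(\frac{\sigma_{\mathcal{K}}^2}{\alpha}+(1+\delta_{\mathcal{K}}\sigma_{\mathcal{K}})^2\right).$$
   Context: Setting: $\mathcal{X}$ is a (real) Banach space and $\mathcal{Y},\mathcal{U},\mathcal{P}$ are (real) Hilbert spaces; $L(V,W)$ denotes the bounded linear operators from $V$ to $W$; $\mathcal{A}\in L(\mathcal{X},\mathcal{P}^* )$ is continuously invertible, $\mathcal{B}\in L(\mathcal{U},\mathcal{P}^* )$, $\mathcal{C}\in L(\mathcal{X},\mathcal{Y})$, and $\alpha>0$. $\mathcal{R}_y:\mathcal{Y}\to\mathcal{Y}^*$ and $\mathcal{R}_u:\mathcal{U}\to\mathcal{U}^*$ are the Riesz isomorphisms, $\langle\cdot,\cdot\rangle_{\mathcal{U},\mathcal{U}^*}$ is the duality pairing, and $T^*$ denotes the Banach space adjoint (so $T\in L(V,W)$ has $T^*\in L(W^*,V^* )$). Condition number: for a symmetric operator $M:\mathcal{U}\to\mathcal{U}^*$, $\kappa(M):=\overline{m}/\underline{m}$, where $0<\underline{m}\le\overline{m}$ are the sharp constants (largest $\underline{m}$, smallest $\overline{m}$) in $\underline{m}\|v\|_{\mathcal{U}}^2\le\langle v,Mv\rangle_{\mathcal{U},\mathcal{U}^*}\le\overline{m}\|v\|_{\mathcal{U}}^2$ for all $v\in\mathcal{U}$ (i.e. relative to the preconditioner $\mathcal{R}_u$). *)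

theory Defs
  imports "HOL-Analysis.Analysis"
begin

type_synonym 'v dual = "'v \<Rightarrow>\<^sub>L real"

abbreviation duality_pairing :: "'v::real_normed_vector \<Rightarrow> 'v dual \<Rightarrow> real"
  where "duality_pairing v f \<equiv> blinfun_apply f v"

definition continuously_invertible ::
    "('v::real_normed_vector \<Rightarrow>\<^sub>L 'w::real_normed_vector) \<Rightarrow> bool"
  where "continuously_invertible T \<longleftrightarrow>
    bij (blinfun_apply T) \<and> continuous_on UNIV (inv (blinfun_apply T))"

lift_definition riesz :: "'v::real_inner \<Rightarrow>\<^sub>L 'v dual"
  is blinfun_inner_left
  by (rule bounded_linear_blinfun_inner_left)

lemma riesz_apply [simp]: "duality_pairing w (riesz v) = v \<bullet> w"
  by transfer (simp add: inner_commute)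

lift_definition banach_adjoint ::
    "('v::real_normed_vector \<Rightarrow>\<^sub>L 'w::real_normed_vector) \<Rightarrow> 'w dual \<Rightarrow>\<^sub>L 'v dual"
  is "\<lambda>T f. f o\<^sub>L T"
  by (rule bounded_linear_intros)+

lemma banach_adjoint_apply [simp]:
  "duality_pairing v (banach_adjoint T f) = duality_pairing (T v) f"
  by transfer simp

text \<open>
  The composite \<open>S T\<^sup>-\<^sup>1 R\<close> as a bounded operator.  It is meaningful when \<open>T\<close> is bijective
  and the composite is bounded; \<open>T\<^sup>-\<^sup>1\<close> itself is not required to be bounded.
\<close>
definition compose_inverse ::
    "('v::real_normed_vector \<Rightarrow>\<^sub>L 'y::real_normed_vector) \<Rightarrow>
     ('v \<Rightarrow>\<^sub>L 'w::real_normed_vector) \<Rightarrow>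
     ('u::real_normed_vector \<Rightarrow>\<^sub>L 'w) \<Rightarrow> 'u \<Rightarrow>\<^sub>L 'y"
  where "compose_inverse S T R =
    Blinfun (\<lambda>u. blinfun_apply S (inv (blinfun_apply T) (blinfun_apply R u)))"

definition M_red ::
    "real \<Rightarrow> ('x::real_normed_vector \<Rightarrow>\<^sub>L 'p::real_normed_vector dual) \<Rightarrow>
     ('u::real_inner \<Rightarrow>\<^sub>L 'p dual) \<Rightarrow> ('x \<Rightarrow>\<^sub>L 'y::real_inner) \<Rightarrow> ('x \<Rightarrow>\<^sub>L 'u) \<Rightarrow>
     'u \<Rightarrow>\<^sub>L 'u dual"
  where "M_red \<alpha> A' B C K =
    (let G = compose_inverse C A' B;
         H = compose_inverse K A' B + id_blinfun
     in (banach_adjoint G o\<^sub>L riesz o\<^sub>L G) + \<alpha> *\<^sub>R (banach_adjoint H o\<^sub>L riesz o\<^sub>L H))"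

definition sharp_lower :: "('u::real_normed_vector \<Rightarrow>\<^sub>L 'u dual) \<Rightarrow> real"
  where "sharp_lower M =
    (GREATEST m. 0 < m \<and> (\<forall>v. m * (norm v)\<^sup>2 \<le> duality_pairing v (M v)))"

definition sharp_upper :: "('u::real_normed_vector \<Rightarrow>\<^sub>L 'u dual) \<Rightarrow> real"
  where "sharp_upper M =
    (LEAST m. 0 < m \<and> (\<forall>v. duality_pairing v (M v) \<le> m * (norm v)\<^sup>2))"

text \<open>
  Meaningful for symmetric coercive \<open>M\<close> on a space with a nonzero vector.  On the zero space
  every constant satisfies both bounds, so there are no sharp constants.
\<close>
definition condition_number :: "('u::real_normed_vector \<Rightarrow>\<^sub>L 'u dual) \<Rightarrow> real"
  where "condition_number M = sharp_upper M / sharp_lower M"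

lemma sharp_lower_greatest:
  fixes M :: "'u::real_normed_vector \<Rightarrow>\<^sub>L 'u dual"
  assumes nz: "\<exists>v::'u. v \<noteq> 0"
    and a: "0 < a" "\<forall>v. a * (norm v)\<^sup>2 \<le> duality_pairing v (M v)"
  shows "0 < sharp_lower M" "a \<le> sharp_lower M"
    "\<And>v. sharp_lower M * (norm v)\<^sup>2 \<le> duality_pairing v (M v)"
proof -
  define S where "S = {m. 0 < m \<and> (\<forall>v. m * (norm v)\<^sup>2 \<le> duality_pairing v (M v))}"
  obtain w :: 'u where w: "w \<noteq> 0" using nz by blast
  have le: "m \<le> duality_pairing w (M w) / (norm w)\<^sup>2" if "m \<in> S" for m
    using that w by (simp add: S_def field_simps)
  have bdd: "bdd_above S" using le by (rule bdd_aboveI)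
  have aS: "a \<in> S" using a by (simp add: S_def)
  have a_le: "a \<le> Sup S" using aS bdd by (rule cSup_upper)
  have Sup_le: "Sup S * (norm v)\<^sup>2 \<le> duality_pairing v (M v)" for v
  proof (cases "v = 0")
    case False
    have "Sup S \<le> duality_pairing v (M v) / (norm v)\<^sup>2"
      using aS False by (intro cSup_least) (auto simp: S_def field_simps)
    then show ?thesis using False by (simp add: field_simps)
  qed (simp add: blinfun.bilinear_simps)
  have eq: "sharp_lower M = Sup S"
    unfolding sharp_lower_def
  proof (rule Greatest_equality)
    show "0 < Sup S \<and> (\<forall>v. Sup S * (norm v)\<^sup>2 \<le> duality_pairing v (M v))"
      using a(1) a_le Sup_le by auto
    show "m \<le> Sup S" if "0 < m \<and> (\<forall>v. m * (norm v)\<^sup>2 \<le> duality_pairing v (M v))" for m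
      using that by (intro cSup_upper bdd) (simp add: S_def)
  qed
  show "0 < sharp_lower M" "a \<le> sharp_lower M"
    "\<And>v. sharp_lower M * (norm v)\<^sup>2 \<le> duality_pairing v (M v)"
    using a_le a(1) Sup_le by (auto simp: eq)
qed

lemma sharp_upper_least:
  fixes M :: "'u::real_normed_vector \<Rightarrow>\<^sub>L 'u dual"
  assumes nz: "\<exists>v::'u. v \<noteq> 0"
    and a: "0 < a" "\<forall>v. a * (norm v)\<^sup>2 \<le> duality_pairing v (M v)"
    and b: "\<forall>v. duality_pairing v (M v) \<le> b * (norm v)\<^sup>2"
  shows "sharp_lower M \<le> sharp_upper M" "sharp_upper M \<le> b"
    "\<And>v. duality_pairing v (M v) \<le> sharp_upper M * (norm v)\<^sup>2"
proof -
  define S where "S = {m. 0 < m \<and> (\<forall>v. duality_pairing v (M v) \<le> m * (norm v)\<^sup>2)}"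
  note low = sharp_lower_greatest[OF nz a]
  obtain w :: 'u where w: "w \<noteq> 0" using nz by blast
  have low_le: "sharp_lower M \<le> m" if "\<forall>v. duality_pairing v (M v) \<le> m * (norm v)\<^sup>2" for m
  proof -
    have "sharp_lower M * (norm w)\<^sup>2 \<le> m * (norm w)\<^sup>2"
      using low(3)[of w] that order_trans by blast
    then show ?thesis using w by simp
  qed
  have bdd: "bdd_below S" using low_le by (intro bdd_belowI[of _ "sharp_lower M"]) (simp add: S_def)
  have bS: "b \<in> S" using b low_le[OF b] low(1) by (simp add: S_def)
  have low_Inf: "sharp_lower M \<le> Inf S"
    using bS low_le by (intro cInf_greatest) (auto simp: S_def)
  have Inf_ge: "duality_pairing v (M v) \<le> Inf S * (norm v)\<^sup>2" for v
  proof (cases "v = 0")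
    case False
    have "duality_pairing v (M v) / (norm v)\<^sup>2 \<le> Inf S"
      using bS False by (intro cInf_greatest) (auto simp: S_def field_simps)
    then show ?thesis using False by (simp add: field_simps)
  qed (simp add: blinfun.bilinear_simps)
  have eq: "sharp_upper M = Inf S"
    unfolding sharp_upper_def
  proof (rule Least_equality)
    show "0 < Inf S \<and> (\<forall>v. duality_pairing v (M v) \<le> Inf S * (norm v)\<^sup>2)"
      using low(1) low_Inf Inf_ge by auto
    show "Inf S \<le> m" if "0 < m \<and> (\<forall>v. duality_pairing v (M v) \<le> m * (norm v)\<^sup>2)" for m
      using that by (intro cInf_lower bdd) (simp add: S_def)
  qed
  show "sharp_lower M \<le> sharp_upper M" "sharp_upper M \<le> b"
    "\<And>v. duality_pairing v (M v) \<le> sharp_upper M * (norm v)\<^sup>2"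
    using low_Inf Inf_ge cInf_lower[OF bS bdd] by (auto simp: eq)
qed

end

theory Submission
  imports Defs
begin

text \<open>
  Write \<open>M\<close> for \<open>M_red\<close>.  For a control \<open>v\<close> let \<open>x = A'\<^sup>-\<^sup>1 B v\<close> be the state it produces.
  The quadratic form of \<open>M\<close> is \<open>\<langle>v, M v\<rangle> = \<parallel>C x\<parallel>\<^sup>2 + \<alpha> \<parallel>K x + v\<parallel>\<^sup>2\<close>
  (\<open>M_red_quadratic_form\<close>), so both bounds concern only the three lengths \<open>\<parallel>C x\<parallel>\<close>,
  \<open>\<parallel>K x + v\<parallel>\<close> and \<open>\<parallel>v\<parallel>\<close>.

  The hypothesis \<open>\<parallel>K x\<parallel> \<le> \<delta> \<parallel>C x\<parallel>\<close> says that the feedback is controlled by the observation.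
  From below, \<open>\<parallel>v\<parallel> \<le> \<parallel>K x + v\<parallel> + \<delta> \<parallel>C x\<parallel>\<close>: the form cannot be small unless \<open>v\<close> is, and the
  weighted Cauchy--Schwarz inequality gives the constant
  \<open>\<alpha> / (1 + \<alpha> \<delta>\<^sup>2)\<close> (\<open>weighted_sum_squares_ge\<close>).  From above, \<open>\<parallel>C x\<parallel> \<le> \<sigma> \<parallel>v\<parallel>\<close> by definition of \<open>\<sigma>\<close>, hence
  \<open>\<parallel>K x + v\<parallel> \<le> (1 + \<delta> \<sigma>) \<parallel>v\<parallel>\<close>.  The condition number is a quotient of sharp constants, hence
  at most the quotient of any two admissible ones.

  The form is built from the composites \<open>C A'\<^sup>-\<^sup>1 B\<close> and \<open>K A'\<^sup>-\<^sup>1 B\<close>, so these must be bounded.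
  The first is bounded because \<open>\<sigma>\<close> is finite, and the second because it is dominated by the first.
\<close>

lemma linear_inv_blinfun:
  assumes "bij (blinfun_apply T)"
  shows "linear (inv (blinfun_apply T))"
proof -
  have surj: "T (inv (blinfun_apply T) w) = w" for w
    using assms by (simp add: bij_is_surj surj_f_inv_f)
  have inj: "inv (blinfun_apply T) (T x) = x" for x
    using assms by (simp add: bij_is_inj)
  show ?thesis
  proof (rule linearI)
    fix a b
    have "inv T (a + b) = inv T (T (inv T a + inv T b))"
      by (simp add: blinfun.add_right surj)
    then show "inv T (a + b) = inv T a + inv T b" by (simp only: inj)
  next
    fix r b
    have "inv T (r *\<^sub>R b) = inv T (T (r *\<^sub>R inv T b))"
      by (simp add: blinfun.scaleR_right surj)
    then show "inv T (r *\<^sub>R b) = r *\<^sub>R inv T b" by (simp only: inj)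
  qed
qed

lemma linear_compose_inverse:
  assumes "bij (blinfun_apply T)"
  shows "linear (\<lambda>u. blinfun_apply S (inv (blinfun_apply T) (blinfun_apply R u)))"
  using linear_compose[OF linear_compose[OF _ linear_inv_blinfun[OF assms]], of R S]
  by (simp add: o_def blinfun.bounded_linear_right bounded_linear.linear)

text \<open>
  At the origin the quotient has the default value \<open>0\<close> and carries no information; there the bound
  comes from linearity.
\<close>
lemma bounded_linear_of_bdd_above_quotient:
  assumes lin: "linear f"
    and bdd: "bdd_above (range (\<lambda>u. norm (f u) / norm u))"
  shows "bounded_linear f"
proof -
  obtain M where M: "norm (f u) / norm u \<le> M" for u
    using bdd by (auto simp: bdd_above_def)
  show ?thesis
  proof (rule bounded_linear_intro[where K = M])
    show "norm (f u) \<le> norm u * M" for u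
      using M[of u] linear_0[OF lin] by (cases "u = 0") (auto simp: field_simps)
  qed (simp_all add: linear_add[OF lin] linear_scale[OF lin])
qed

lemma bounded_linear_dominated:
  assumes lin: "linear g" and f: "bounded_linear f"
    and le: "\<And>u. norm (g u) \<le> c * norm (f u)" and c: "0 \<le> c"
  shows "bounded_linear g"
proof (rule bounded_linear_intro[where K = "c * onorm f"])
  show "norm (g u) \<le> norm u * (c * onorm f)" for u
    using order_trans[OF le mult_left_mono[OF onorm[OF f] c]] by (simp add: mult_ac)
qed (simp_all add: linear_add[OF lin] linear_scale[OF lin])

text \<open>
  Up to the factor \<open>\<alpha>\<close>, each summand of \<open>M_red\<close> has the form \<open>T\<^sup>* R T\<close>, whose quadratic form is \<open>\<parallel>T v\<parallel>\<^sup>2\<close>.  The two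
  boundedness assumptions ensure that the composites inside \<open>M_red\<close> are the intended operators.
\<close>
lemma M_red_quadratic_form:
  assumes C: "bounded_linear (\<lambda>u. blinfun_apply C (inv (blinfun_apply A') (blinfun_apply B u)))"
    and K: "bounded_linear (\<lambda>u. blinfun_apply K (inv (blinfun_apply A') (blinfun_apply B u)))"
  shows "duality_pairing v (M_red \<alpha> A' B C K v) =
    (norm (C (inv (blinfun_apply A') (B v))))\<^sup>2 +
    \<alpha> * (norm (K (inv (blinfun_apply A') (B v)) + v))\<^sup>2"
  by (simp add: M_red_def Let_def compose_inverse_def bounded_linear_Blinfun_apply[OF C]
      bounded_linear_Blinfun_apply[OF K] blinfun.add_left blinfun.scaleR_left
      flip: power2_norm_eq_inner)

text \<open>
  Cauchy--Schwarz for \<open>n \<le> (1 / sqrt \<alpha>) (sqrt \<alpha> b) + \<delta> a\<close>.  The factor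
  \<open>\<alpha> / (1 + \<alpha> \<delta>\<^sup>2)\<close> is the reciprocal of \<open>1 / \<alpha> + \<delta>\<^sup>2\<close>.
\<close>
lemma weighted_sum_squares_ge:
  fixes \<alpha> \<delta> a b n :: real
  assumes "0 < \<alpha>" "0 \<le> n" "n \<le> b + \<delta> * a"
  shows "\<alpha> / (1 + \<alpha> * \<delta>\<^sup>2) * n\<^sup>2 \<le> a\<^sup>2 + \<alpha> * b\<^sup>2"
proof -
  have "\<alpha> * n\<^sup>2 \<le> \<alpha> * (b + \<delta> * a)\<^sup>2"
    using assms by (simp add: power_mono)
  (* The defect in Cauchy--Schwarz is a perfect square. *)
  also have "\<dots> = (1 + \<alpha> * \<delta>\<^sup>2) * (a\<^sup>2 + \<alpha> * b\<^sup>2) - (a - \<alpha> * \<delta> * b)\<^sup>2"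
    by (simp add: power2_eq_square algebra_simps)
  also have "\<dots> \<le> (1 + \<alpha> * \<delta>\<^sup>2) * (a\<^sup>2 + \<alpha> * b\<^sup>2)"
    by simp
  finally have "\<alpha> * n\<^sup>2 \<le> (1 + \<alpha> * \<delta>\<^sup>2) * (a\<^sup>2 + \<alpha> * b\<^sup>2)" .
  moreover have "0 < 1 + \<alpha> * \<delta>\<^sup>2"
    using assms(1) by (simp add: add_pos_nonneg)
  ultimately show ?thesis
    by (simp add: divide_le_eq mult.commute)
qed

lemma condition_number_le:
  fixes M :: "'u::real_normed_vector \<Rightarrow>\<^sub>L 'u dual"
  assumes nz: "\<exists>v::'u. v \<noteq> 0"
    and a: "0 < a" "\<forall>v. a * (norm v)\<^sup>2 \<le> duality_pairing v (M v)"
    and b: "\<forall>v. duality_pairing v (M v) \<le> b * (norm v)\<^sup>2"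
  shows "condition_number M \<le> b / a"
proof -
  note lower = sharp_lower_greatest[OF nz a] and upper = sharp_upper_least[OF nz a b]
  show ?thesis
    unfolding condition_number_def
    by (rule frac_le) (use lower upper a in linarith)+
qed

theorem proposition3p3:
  fixes A A' :: "'x::banach \<Rightarrow>\<^sub>L 'p::{real_inner,complete_space} dual"
    and B :: "'u::{real_inner,complete_space} \<Rightarrow>\<^sub>L 'p dual"
    and C :: "'x \<Rightarrow>\<^sub>L 'y::{real_inner,complete_space}"
    and K :: "'x \<Rightarrow>\<^sub>L 'u"
    and \<alpha> \<delta> \<sigma> :: real
  assumes A_inv: "continuously_invertible A"
    and alpha_pos: "0 < \<alpha>"
    and A'_eq: "A' = A - (B o\<^sub>L K)"
    and A'_inv: "bij (blinfun_apply A')"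
    and sigma_finite: "bdd_above (range (\<lambda>u. norm (C (inv (blinfun_apply A') (B u))) / norm u))"
    and sigma_eq: "\<sigma> = onorm (\<lambda>u. C (inv (blinfun_apply A') (B u)))"
    and delta_pos: "0 < \<delta>"
    and delta_bound: "\<And>x. norm (K x) \<le> \<delta> * norm (C x)"
  shows "(\<forall>v. \<alpha> / (1 + \<alpha> * \<delta>\<^sup>2) * (norm v)\<^sup>2 \<le> duality_pairing v (M_red \<alpha> A' B C K v) \<and>
              duality_pairing v (M_red \<alpha> A' B C K v) \<le> (\<sigma>\<^sup>2 + \<alpha> * (1 + \<delta> * \<sigma>)\<^sup>2) * (norm v)\<^sup>2) \<and>
         ((\<exists>v::'u. v \<noteq> 0) \<longrightarrow>
            condition_number (M_red \<alpha> A' B C K)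
              \<le> (1 + \<alpha> * \<delta>\<^sup>2) * (\<sigma>\<^sup>2 / \<alpha> + (1 + \<delta> * \<sigma>)\<^sup>2))"
proof -
  define x where "x v = inv (blinfun_apply A') (B v)" for v
  have bl_C: "bounded_linear (\<lambda>u. C (x u))"
    unfolding x_def
    by (rule bounded_linear_of_bdd_above_quotient[OF linear_compose_inverse[OF A'_inv] sigma_finite])
  have lin_K: "linear (\<lambda>u. K (x u))"
    unfolding x_def by (rule linear_compose_inverse[OF A'_inv])
  have bl_K: "bounded_linear (\<lambda>u. K (x u))"
    using delta_pos by (intro bounded_linear_dominated[OF lin_K bl_C delta_bound]) simp
  have form: "duality_pairing v (M_red \<alpha> A' B C K v) =
      (norm (C (x v)))\<^sup>2 + \<alpha> * (norm (K (x v) + v))\<^sup>2" for v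
    using M_red_quadratic_form[OF bl_C[unfolded x_def] bl_K[unfolded x_def]]
    by (simp add: x_def)
  have C_le: "norm (C (x v)) \<le> \<sigma> * norm v" for v
    using onorm[OF bl_C, of v] by (simp add: sigma_eq x_def)
  have lower: "\<alpha> / (1 + \<alpha> * \<delta>\<^sup>2) * (norm v)\<^sup>2 \<le> duality_pairing v (M_red \<alpha> A' B C K v)" for v
  proof -
    have "norm v \<le> norm (K (x v) + v) + norm (K (x v))"
      using norm_triangle_ineq4[of "K (x v) + v" "K (x v)"] by simp
    also have "\<dots> \<le> norm (K (x v) + v) + \<delta> * norm (C (x v))"
      using delta_bound by simp
    finally show ?thesis
      unfolding form by (rule weighted_sum_squares_ge[OF alpha_pos norm_ge_zero])
  qed
  have upper: "duality_pairing v (M_red \<alpha> A' B C K v)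
      \<le> (\<sigma>\<^sup>2 + \<alpha> * (1 + \<delta> * \<sigma>)\<^sup>2) * (norm v)\<^sup>2" for v
  proof -
    have "norm (K (x v) + v) \<le> \<delta> * norm (C (x v)) + norm v"
      using norm_triangle_ineq[of "K (x v)" v] delta_bound[of "x v"] by linarith
    also have "\<dots> \<le> (1 + \<delta> * \<sigma>) * norm v"
      using mult_left_mono[OF C_le, of \<delta> v] delta_pos by (simp add: algebra_simps)
    finally have "(norm (K (x v) + v))\<^sup>2 \<le> ((1 + \<delta> * \<sigma>) * norm v)\<^sup>2"
      by (simp add: power_mono)
    moreover have "(norm (C (x v)))\<^sup>2 \<le> (\<sigma> * norm v)\<^sup>2"
      using C_le by (simp add: power_mono)
    ultimately have "duality_pairing v (M_red \<alpha> A' B C K v)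
        \<le> (\<sigma> * norm v)\<^sup>2 + \<alpha> * ((1 + \<delta> * \<sigma>) * norm v)\<^sup>2"
      using alpha_pos unfolding form by (intro add_mono mult_left_mono) auto
    then show ?thesis
      unfolding power_mult_distrib by (simp add: distrib_right mult.assoc)
  qed
  have denom: "0 < 1 + \<alpha> * \<delta>\<^sup>2"
    using alpha_pos by (simp add: add_pos_nonneg)
  have cond: "condition_number (M_red \<alpha> A' B C K)
      \<le> (1 + \<alpha> * \<delta>\<^sup>2) * (\<sigma>\<^sup>2 / \<alpha> + (1 + \<delta> * \<sigma>)\<^sup>2)" if nz: "\<exists>v::'u. v \<noteq> 0"
  proof -
    have "condition_number (M_red \<alpha> A' B C K)
        \<le> (\<sigma>\<^sup>2 + \<alpha> * (1 + \<delta> * \<sigma>)\<^sup>2) / (\<alpha> / (1 + \<alpha> * \<delta>\<^sup>2))"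
      using alpha_pos denom lower upper by (intro condition_number_le[OF nz]) auto
    also have "\<dots> = (1 + \<alpha> * \<delta>\<^sup>2) * ((\<sigma>\<^sup>2 + \<alpha> * (1 + \<delta> * \<sigma>)\<^sup>2) / \<alpha>)"
      by simp
    also have "\<dots> = (1 + \<alpha> * \<delta>\<^sup>2) * (\<sigma>\<^sup>2 / \<alpha> + (1 + \<delta> * \<sigma>)\<^sup>2)"
      using alpha_pos by (simp add: add_divide_distrib)
    finally show ?thesis .
  qed
  show ?thesis
    by (intro conjI allI impI lower upper cond)
qed

end
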